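(* Let $R$ be a ring, let $\alpha\colon M\to\operatorname{Hom}(M,W)$ be an alternating module representation over $R$, and let $A$ be an associative, commutative, and unital $R$-algebra. Suppose that the group $\mathsf G_\alpha(A)$ is finite. Then $$\operatorname{k}(\mathsf G_\alpha(A))=|W_A|\cdot\operatorname{ask}(2\alpha^A).$$
   Context: Rings are associative, commutative, and unital. Maps act on the right. $\operatorname{k}(H)$ denotes the number of conjugacy classes of a finite group $H$. A module representation over $R$ is an $R$-module homomorphism $\theta\colon M\to\operatorname{Hom}(V,W)$, where $M,V,W$ are $R$-modules; write $x*_\theta a=x(a\theta)$ for $x\in V$, $a\in M$. It is alternating if $M=V$ and $a*_\theta a=0$ for all $a\in M$. If $M$ and $V$ are finite as sets, $\operatorname{ask}(\theta)=\frac1{|M|}\sum_{a\in M}|\operatorname{Ker}(a\theta)|$. For an $R$-algebra $A$ and an $R$-module $U$, write $U_A=U\otimes_R A$. The change of scalars $\theta^A$ of $\theta$ is the induced module representation $M_A\to\operatorname{Hom}_A(V_A,W_A)$ over $A$. $2\alpha^A$ denotes the map $a\mapsto 2(a\alpha^A)$. For an alternating $\alpha\colon M\to\operatorname{Hom}(M,W)$, $\mathsf G_\alpha(A)$ is the group with underlying set $M_A\times W_A$ and multiplication $(a,y)\cdot(a',y')=(a+a',\,y+y'+(a*_{\alpha^A}a'))$ for $a,a'\in M_A$, $y,y'\in W_A$. *)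

theory Defs
  imports Complex_Main "HOL-Algebra.Algebra"
begin

section \<open>Module representations\<close>

text \<open>Homomorphisms are taken extensional, so that a homomorphism is determined by its values
  on the carrier of its domain.\<close>

definition mod_hom ::
  "('r, 'x) ring_scheme \<Rightarrow> ('r, 'v, 'y) module_scheme \<Rightarrow> ('r, 'w, 'z) module_scheme \<Rightarrow> ('v \<Rightarrow> 'w) set"
  where "mod_hom R V W = {f \<in> carrier V \<rightarrow>\<^sub>E carrier W.
     (\<forall>x\<in>carrier V. \<forall>y\<in>carrier V. f (x \<oplus>\<^bsub>V\<^esub> y) = f x \<oplus>\<^bsub>W\<^esub> f y) \<and>
     (\<forall>r\<in>carrier R. \<forall>x\<in>carrier V. f (r \<odot>\<^bsub>V\<^esub> x) = r \<odot>\<^bsub>W\<^esub> f x)}"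

text \<open>The record type of modules extends that of rings; the ring multiplication and unit of a
  module play no role and are left undefined.\<close>

definition hom_module ::
  "('r, 'x) ring_scheme \<Rightarrow> ('r, 'v, 'y) module_scheme \<Rightarrow> ('r, 'w, 'z) module_scheme
    \<Rightarrow> ('r, 'v \<Rightarrow> 'w) module"
  where "hom_module R V W =
    \<lparr>carrier = mod_hom R V W,
     monoid.mult = undefined, one = undefined,
     ring.zero = (\<lambda>x\<in>carrier V. \<zero>\<^bsub>W\<^esub>),
     ring.add = (\<lambda>f g. \<lambda>x\<in>carrier V. f x \<oplus>\<^bsub>W\<^esub> g x),
     module.smult = (\<lambda>r f. \<lambda>x\<in>carrier V. r \<odot>\<^bsub>W\<^esub> f x)\<rparr>"

definition module_rep ::
  "('r, 'x) ring_scheme \<Rightarrow> ('r, 'm, 'y) module_scheme \<Rightarrow> ('r, 'v, 'z) module_scheme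
    \<Rightarrow> ('r, 'w, 'u) module_scheme \<Rightarrow> ('m \<Rightarrow> 'v \<Rightarrow> 'w) \<Rightarrow> bool"
  where "module_rep R M V W \<theta> \<longleftrightarrow>
    module R M \<and> module R V \<and> module R W \<and> \<theta> \<in> mod_hom R M (hom_module R V W)"

text \<open>Maps act on the right on paper: \<open>x *\<^sub>\<theta> a = x(a\<theta>)\<close>.\<close>

definition rep_mult :: "('m \<Rightarrow> 'v \<Rightarrow> 'w) \<Rightarrow> 'v \<Rightarrow> 'm \<Rightarrow> 'w"
  where "rep_mult \<theta> x a = \<theta> a x"

definition alternating_rep ::
  "('r, 'x) ring_scheme \<Rightarrow> ('r, 'm, 'y) module_scheme \<Rightarrow> ('r, 'w, 'z) module_scheme
    \<Rightarrow> ('m \<Rightarrow> 'm \<Rightarrow> 'w) \<Rightarrow> bool"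
  where "alternating_rep R M W \<alpha> \<longleftrightarrow>
    module_rep R M M W \<alpha> \<and> (\<forall>a\<in>carrier M. rep_mult \<alpha> a a = \<zero>\<^bsub>W\<^esub>)"

definition ask ::
  "('r, 'm, 'x) module_scheme \<Rightarrow> ('r, 'v, 'y) module_scheme \<Rightarrow> ('r, 'w, 'z) module_scheme
    \<Rightarrow> ('m \<Rightarrow> 'v \<Rightarrow> 'w) \<Rightarrow> real"
  where "ask M V W \<theta> =
    1 / real (card (carrier M)) * (\<Sum>a\<in>carrier M. real (card (a_kernel V W (\<theta> a))))"

definition double_rep ::
  "('r, 'x) ring_scheme \<Rightarrow> ('r, 'm, 'y) module_scheme \<Rightarrow> ('r, 'v, 'z) module_scheme
    \<Rightarrow> ('r, 'w, 'u) module_scheme \<Rightarrow> ('m \<Rightarrow> 'v \<Rightarrow> 'w) \<Rightarrow> 'm \<Rightarrow> 'v \<Rightarrow> 'w"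
  where "double_rep R M V W \<theta> = (\<lambda>a\<in>carrier M. add_pow (hom_module R V W) (2::nat) (\<theta> a))"


section \<open>Change of scalars\<close>

text \<open>The tensor product of \<open>U\<close> and \<open>A\<close> over \<open>R\<close> is the free abelian group on pairs \<open>(u, a)\<close>
  modulo the subgroup generated by the following elements.\<close>

inductive_set tensor_rels ::
  "('r, 'x) ring_scheme \<Rightarrow> ('r, 'u, 'y) module_scheme \<Rightarrow> ('r, 'a, 'z) module_scheme
    \<Rightarrow> (('u \<times> 'a) \<Rightarrow>\<^sub>0 int) set"
  for R U A
  where
    add_left: "\<lbrakk>u \<in> carrier U; u' \<in> carrier U; a \<in> carrier A\<rbrakk> \<Longrightarrow>
      frag_of (u \<oplus>\<^bsub>U\<^esub> u', a) - frag_of (u, a) - frag_of (u', a) \<in> tensor_rels R U A"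
  | add_right: "\<lbrakk>u \<in> carrier U; a \<in> carrier A; a' \<in> carrier A\<rbrakk> \<Longrightarrow>
      frag_of (u, a \<oplus>\<^bsub>A\<^esub> a') - frag_of (u, a) - frag_of (u, a') \<in> tensor_rels R U A"
  | balanced: "\<lbrakk>r \<in> carrier R; u \<in> carrier U; a \<in> carrier A\<rbrakk> \<Longrightarrow>
      frag_of (r \<odot>\<^bsub>U\<^esub> u, a) - frag_of (u, r \<odot>\<^bsub>A\<^esub> a) \<in> tensor_rels R U A"

abbreviation tensor_free ::
  "('r, 'u, 'y) module_scheme \<Rightarrow> ('r, 'a, 'z) module_scheme \<Rightarrow> (('u \<times> 'a) \<Rightarrow>\<^sub>0 int) monoid"
  where "tensor_free U A \<equiv> free_Abelian_group (carrier U \<times> carrier A)"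

definition tensor_null ::
  "('r, 'x) ring_scheme \<Rightarrow> ('r, 'u, 'y) module_scheme \<Rightarrow> ('r, 'a, 'z) module_scheme
    \<Rightarrow> (('u \<times> 'a) \<Rightarrow>\<^sub>0 int) set"
  where "tensor_null R U A = generate (tensor_free U A) (tensor_rels R U A)"

definition pure_tensor ::
  "('r, 'x) ring_scheme \<Rightarrow> ('r, 'u, 'y) module_scheme \<Rightarrow> ('r, 'a, 'z) module_scheme
    \<Rightarrow> 'u \<Rightarrow> 'a \<Rightarrow> (('u \<times> 'a) \<Rightarrow>\<^sub>0 int) set"
  where "pure_tensor R U A u a = tensor_null R U A #>\<^bsub>tensor_free U A\<^esub> frag_of (u, a)"

text \<open>The \<open>A\<close>-module \<open>U\<^sub>A\<close>. Its elements are cosets. The action of \<open>b\<close> is induced by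
  \<open>(u, a) \<mapsto> (u, b a)\<close>: this map sends a coset into a single coset, which is recovered by adding
  the subgroup of relations.\<close>

definition base_change ::
  "('r, 'x) ring_scheme \<Rightarrow> ('r, 'a, 'z) module_scheme \<Rightarrow> ('r, 'u, 'y) module_scheme
    \<Rightarrow> ('a, (('u \<times> 'a) \<Rightarrow>\<^sub>0 int) set) module"
  where "base_change R A U =
    (let F = tensor_free U A; N = tensor_null R U A in
    \<lparr>carrier = carrier (F Mod N),
     monoid.mult = undefined, one = undefined,
     ring.zero = \<one>\<^bsub>F Mod N\<^esub>,
     ring.add = (\<lambda>S T. S \<otimes>\<^bsub>F Mod N\<^esub> T),
     module.smult = (\<lambda>b S. N <#>\<^bsub>F\<^esub> frag_extend (\<lambda>(u, a). frag_of (u, b \<otimes>\<^bsub>A\<^esub> a)) ` S)\<rparr>)"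

text \<open>The induced module representation over \<open>A\<close>, characterised by
  \<open>(x \<otimes> b) * (m \<otimes> a) = (x * m) \<otimes> b a\<close>.\<close>

definition is_change_of_scalars ::
  "('r, 'x) ring_scheme \<Rightarrow> ('r, 'a, 'z) module_scheme \<Rightarrow> ('r, 'm, 'y) module_scheme
    \<Rightarrow> ('r, 'v, 'u) module_scheme \<Rightarrow> ('r, 'w, 't) module_scheme \<Rightarrow> ('m \<Rightarrow> 'v \<Rightarrow> 'w)
    \<Rightarrow> ((('m \<times> 'a) \<Rightarrow>\<^sub>0 int) set \<Rightarrow> (('v \<times> 'a) \<Rightarrow>\<^sub>0 int) set \<Rightarrow> (('w \<times> 'a) \<Rightarrow>\<^sub>0 int) set) \<Rightarrow> bool"
  where "is_change_of_scalars R A M V W \<theta> \<Theta> \<longleftrightarrow>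
    module_rep A (base_change R A M) (base_change R A V) (base_change R A W) \<Theta> \<and>
    (\<forall>m\<in>carrier M. \<forall>a\<in>carrier A. \<forall>x\<in>carrier V. \<forall>b\<in>carrier A.
       rep_mult \<Theta> (pure_tensor R V A x b) (pure_tensor R M A m a)
         = pure_tensor R W A (rep_mult \<theta> x m) (b \<otimes>\<^bsub>A\<^esub> a))"

definition change_of_scalars ::
  "('r, 'x) ring_scheme \<Rightarrow> ('r, 'a, 'z) module_scheme \<Rightarrow> ('r, 'm, 'y) module_scheme
    \<Rightarrow> ('r, 'v, 'u) module_scheme \<Rightarrow> ('r, 'w, 't) module_scheme \<Rightarrow> ('m \<Rightarrow> 'v \<Rightarrow> 'w)
    \<Rightarrow> ((('m \<times> 'a) \<Rightarrow>\<^sub>0 int) set \<Rightarrow> (('v \<times> 'a) \<Rightarrow>\<^sub>0 int) set \<Rightarrow> (('w \<times> 'a) \<Rightarrow>\<^sub>0 int) set)"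
  where "change_of_scalars R A M V W \<theta> = (THE \<Theta>. is_change_of_scalars R A M V W \<theta> \<Theta>)"


section \<open>The group of an alternating module representation\<close>

definition Baer_group ::
  "('r, 'x) ring_scheme \<Rightarrow> ('r, 'm, 'y) module_scheme \<Rightarrow> ('r, 'w, 'z) module_scheme
    \<Rightarrow> ('m \<Rightarrow> 'm \<Rightarrow> 'w) \<Rightarrow> ('r, 'a, 't) module_scheme
    \<Rightarrow> ((('m \<times> 'a) \<Rightarrow>\<^sub>0 int) set \<times> (('w \<times> 'a) \<Rightarrow>\<^sub>0 int) set) monoid"
  where "Baer_group R M W \<alpha> A =
    (let M\<^sub>A = base_change R A M; W\<^sub>A = base_change R A W;
         \<alpha>\<^sub>A = change_of_scalars R A M M W \<alpha> in
    \<lparr>carrier = carrier M\<^sub>A \<times> carrier W\<^sub>A,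
     monoid.mult = (\<lambda>(a, y) (a', y').
       (a \<oplus>\<^bsub>M\<^sub>A\<^esub> a', y \<oplus>\<^bsub>W\<^sub>A\<^esub> y' \<oplus>\<^bsub>W\<^sub>A\<^esub> rep_mult \<alpha>\<^sub>A a a')),
     one = (\<zero>\<^bsub>M\<^sub>A\<^esub>, \<zero>\<^bsub>W\<^sub>A\<^esub>)\<rparr>)"

definition conj_class_number :: "('g, 'x) monoid_scheme \<Rightarrow> nat"
  where "conj_class_number G =
    card (orbits G (carrier G) (\<lambda>g. \<lambda>h\<in>carrier G. g \<otimes>\<^bsub>G\<^esub> h \<otimes>\<^bsub>G\<^esub> inv\<^bsub>G\<^esub> g))"


section \<open>The change of scalars is well defined\<close>

text \<open>\<open>U\<^sub>A\<close> is an \<open>A\<close>-module with the universal property of the tensor product, and the induced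
  module representation exists and is unique; so the definite description above denotes it.\<close>


lemma mod_homD:
  assumes "f \<in> mod_hom R V W"
  shows "x \<in> carrier V \<Longrightarrow> f x \<in> carrier W"
    "x \<in> carrier V \<Longrightarrow> y \<in> carrier V \<Longrightarrow> f (x \<oplus>\<^bsub>V\<^esub> y) = f x \<oplus>\<^bsub>W\<^esub> f y"
    "r \<in> carrier R \<Longrightarrow> x \<in> carrier V \<Longrightarrow> f (r \<odot>\<^bsub>V\<^esub> x) = r \<odot>\<^bsub>W\<^esub> f x"
    "f \<in> extensional (carrier V)"
  using assms unfolding mod_hom_def by (auto simp: PiE_def extensional_def)

lemma mod_homI:
  assumes "\<And>x. x \<in> carrier V \<Longrightarrow> f x \<in> carrier W"
    "\<And>x y. x \<in> carrier V \<Longrightarrow> y \<in> carrier V \<Longrightarrow> f (x \<oplus>\<^bsub>V\<^esub> y) = f x \<oplus>\<^bsub>W\<^esub> f y"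
    "\<And>r x. r \<in> carrier R \<Longrightarrow> x \<in> carrier V \<Longrightarrow> f (r \<odot>\<^bsub>V\<^esub> x) = r \<odot>\<^bsub>W\<^esub> f x"
    "f \<in> extensional (carrier V)"
  shows "f \<in> mod_hom R V W"
  using assms unfolding mod_hom_def by (auto simp: PiE_def extensional_def)

lemma hom_module_simps [simp]:
  "carrier (hom_module R V W) = mod_hom R V W"
  "\<zero>\<^bsub>hom_module R V W\<^esub> = (\<lambda>x\<in>carrier V. \<zero>\<^bsub>W\<^esub>)"
  "f \<oplus>\<^bsub>hom_module R V W\<^esub> g = (\<lambda>x\<in>carrier V. f x \<oplus>\<^bsub>W\<^esub> g x)"
  "r \<odot>\<^bsub>hom_module R V W\<^esub> f = (\<lambda>x\<in>carrier V. r \<odot>\<^bsub>W\<^esub> f x)"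
  by (simp_all add: hom_module_def)

lemma module_hom_module:
  assumes "module R V" "module R W"
  shows "module R (hom_module R V W)"
proof -
  interpret V: module R V by fact
  interpret W: module R W by fact
  note D = mod_homD
  have ext: "f = g" if "f \<in> mod_hom R V W" "g \<in> mod_hom R V W" "\<And>x. x \<in> carrier V \<Longrightarrow> f x = g x" for f g
    using that by (meson D(4) extensionalityI)
  have add: "f \<oplus>\<^bsub>hom_module R V W\<^esub> g \<in> mod_hom R V W"
    if "f \<in> mod_hom R V W" "g \<in> mod_hom R V W" for f g
    by (rule mod_homI) (auto simp: D[OF that(1)] D[OF that(2)] W.a_ac W.smult_r_distr)
  have sm: "r \<odot>\<^bsub>hom_module R V W\<^esub> f \<in> mod_hom R V W"
    if "r \<in> carrier R" "f \<in> mod_hom R V W" for f r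
    by (rule mod_homI) (use that in \<open>auto simp: D[OF that(2)] W.smult_r_distr V.R.m_comm simp flip: W.smult_assoc1\<close>)
  have z: "\<zero>\<^bsub>hom_module R V W\<^esub> \<in> mod_hom R V W"
    by (rule mod_homI) auto
  note add' = add[unfolded hom_module_simps] and sm' = sm[unfolded hom_module_simps] and z' = z[unfolded hom_module_simps]
  have ag: "abelian_group (hom_module R V W)"
  proof (rule abelian_groupI, simp_all only: hom_module_simps)
    fix f assume f: "f \<in> mod_hom R V W"
    show "\<exists>g\<in>mod_hom R V W. (\<lambda>x\<in>carrier V. g x \<oplus>\<^bsub>W\<^esub> f x) = (\<lambda>x\<in>carrier V. \<zero>\<^bsub>W\<^esub>)"
    proof (rule bexI)
      show "(\<lambda>x\<in>carrier V. \<ominus>\<^bsub>W\<^esub> f x) \<in> mod_hom R V W"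
        by (rule mod_homI) (auto simp: D[OF f] W.minus_add W.smult_r_minus)
      show "(\<lambda>x\<in>carrier V. (\<lambda>x\<in>carrier V. \<ominus>\<^bsub>W\<^esub> f x) x \<oplus>\<^bsub>W\<^esub> f x) = (\<lambda>x\<in>carrier V. \<zero>\<^bsub>W\<^esub>)"
        by (auto simp: D[OF f] W.l_neg)
    qed
  next
    fix f assume f: "f \<in> mod_hom R V W"
    show "(\<lambda>x\<in>carrier V. (\<lambda>x\<in>carrier V. \<zero>\<^bsub>W\<^esub>) x \<oplus>\<^bsub>W\<^esub> f x) = f"
      by (rule ext) (use f in \<open>auto simp: D[OF f] intro: mod_homI\<close>)
  qed (auto simp: add' z' D W.a_ac)
  show ?thesis
  proof (rule moduleI[OF V.R.is_cring ag], simp_all only: hom_module_simps)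
    fix f assume f: "f \<in> mod_hom R V W"
    show "(\<lambda>x\<in>carrier V. \<one>\<^bsub>R\<^esub> \<odot>\<^bsub>W\<^esub> f x) = f"
      by (rule ext) (use f in \<open>auto simp: D[OF f] intro: mod_homI\<close>)
  qed (auto simp: sm' D W.smult_r_distr W.smult_l_distr W.smult_assoc1)
qed

locale base_change_setup = U: module R U + A: algebra R A for R U A
begin

abbreviation "F \<equiv> tensor_free U A"
abbreviation "N \<equiv> tensor_null R U A"
abbreviation "UA \<equiv> base_change R A U"
abbreviation "T \<equiv> pure_tensor R U A"

lemma comm_F: "comm_group F" by (rule abelian_free_Abelian_group)

lemma keys_diff2: "Poly_Mapping.keys a \<subseteq> S \<Longrightarrow> Poly_Mapping.keys b \<subseteq> S \<Longrightarrow> Poly_Mapping.keys (a - b) \<subseteq> S"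
  by (meson Un_least order.trans keys_diff)

lemma keys_add2: "Poly_Mapping.keys a \<subseteq> S \<Longrightarrow> Poly_Mapping.keys b \<subseteq> S \<Longrightarrow> Poly_Mapping.keys (a + b) \<subseteq> S"
  by (meson Un_least order.trans keys_add)

lemma rels_F: "tensor_rels R U A \<subseteq> carrier F"
proof
  fix c assume "c \<in> tensor_rels R U A"
  then show "c \<in> carrier F"
    by (induction) (simp_all add: keys_diff2 keys_frag_of)
qed

lemma N_sub: "subgroup N F"
  unfolding tensor_null_def by (rule group.generate_is_subgroup[OF group_free_Abelian_group rels_F])

lemma N_normal: "N \<lhd> F"
  by (rule comm_group.subgroup_imp_normal[OF comm_F N_sub])

lemma comm_UA: "comm_group (F Mod N)"
  by (rule comm_group.abelian_FactGroup[OF comm_F N_sub])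

lemma UA_simps: "carrier UA = carrier (F Mod N)" "\<zero>\<^bsub>UA\<^esub> = \<one>\<^bsub>F Mod N\<^esub>"
   "x \<oplus>\<^bsub>UA\<^esub> y = x \<otimes>\<^bsub>F Mod N\<^esub> y"
   "b \<odot>\<^bsub>UA\<^esub> s = N <#>\<^bsub>F\<^esub> frag_extend (\<lambda>(u, a). frag_of (u, b \<otimes>\<^bsub>A\<^esub> a)) ` s"
  by (simp_all add: base_change_def Let_def)

lemma add_monoid_UA:
  "carrier (add_monoid UA) = carrier (F Mod N)" "monoid.mult (add_monoid UA) = monoid.mult (F Mod N)"
  "one (add_monoid UA) = one (F Mod N)"
  by (simp_all add: base_change_def Let_def)

lemma ag_UA: "abelian_group UA"
proof -
  interpret Q: comm_group "F Mod N" by (rule comm_UA)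
  show ?thesis
    by (rule abelian_groupI; unfold UA_simps;
        (rule Q.m_closed Q.one_closed Q.m_assoc Q.m_comm Q.l_one Q.l_inv_ex; assumption))
qed

lemma cos_carr: "c \<in> carrier F \<Longrightarrow> N #>\<^bsub>F\<^esub> c \<in> carrier UA"
  by (auto simp: UA_simps FactGroup_def RCOSETS_def)

lemma cos_ex: assumes "s \<in> carrier UA" obtains c where "c \<in> carrier F" "s = N #>\<^bsub>F\<^esub> c"
  using assms by (auto simp: UA_simps FactGroup_def RCOSETS_def)

lemma cos_add: "c \<in> carrier F \<Longrightarrow> d \<in> carrier F \<Longrightarrow>
   (N #>\<^bsub>F\<^esub> c) \<oplus>\<^bsub>UA\<^esub> (N #>\<^bsub>F\<^esub> d) = N #>\<^bsub>F\<^esub> (c + d)"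
  using normal.rcos_sum[OF N_normal, of c d] by (simp add: UA_simps FactGroup_def)

lemma cos_eq: "c \<in> carrier F \<Longrightarrow> d \<in> carrier F \<Longrightarrow> c - d \<in> N \<Longrightarrow> N #>\<^bsub>F\<^esub> c = N #>\<^bsub>F\<^esub> d"
proof -
  assume a: "c \<in> carrier F" "d \<in> carrier F" "c - d \<in> N"
  interpret F: comm_group F by (rule comm_F)
  have "c \<in> N #>\<^bsub>F\<^esub> d" using a(3) by (force simp: r_coset_def)
  then show ?thesis using F.repr_independence[OF _ a(2) N_sub] by auto
qed

lemma rels_N: "c \<in> tensor_rels R U A \<Longrightarrow> c \<in> N"
  unfolding tensor_null_def by (rule generate.incl)

lemma T_carr: "u \<in> carrier U \<Longrightarrow> a \<in> carrier A \<Longrightarrow> T u a \<in> carrier UA"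
  unfolding pure_tensor_def by (rule cos_carr) auto

lemma frag_F: "u \<in> carrier U \<Longrightarrow> a \<in> carrier A \<Longrightarrow> frag_of (u,a) \<in> carrier F" by auto

lemma F_add: "c \<in> carrier F \<Longrightarrow> d \<in> carrier F \<Longrightarrow> c + d \<in> carrier F"
  using group.subgroup_self comm_group.axioms comm_F
  by (metis group_free_Abelian_group group.is_monoid monoid.m_closed mult_free_Abelian_group)

lemma T_add_left: assumes "u \<in> carrier U" "u' \<in> carrier U" "a \<in> carrier A"
  shows "T (u \<oplus>\<^bsub>U\<^esub> u') a = T u a \<oplus>\<^bsub>UA\<^esub> T u' a"
proof -
  have "T u a \<oplus>\<^bsub>UA\<^esub> T u' a = N #>\<^bsub>F\<^esub> (frag_of (u,a) + frag_of (u',a))"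
    unfolding pure_tensor_def by (rule cos_add) (use assms in \<open>auto\<close>)
  also have "\<dots> = T (u \<oplus>\<^bsub>U\<^esub> u') a"
    unfolding pure_tensor_def
    by (rule cos_eq[symmetric]) (use assms rels_N[OF tensor_rels.add_left[OF assms]] in \<open>simp_all add: diff_diff_eq keys_add2\<close>)
  finally show ?thesis by simp
qed

lemma T_add_right: assumes "u \<in> carrier U" "a' \<in> carrier A" "a \<in> carrier A"
  shows "T u (a \<oplus>\<^bsub>A\<^esub> a') = T u a \<oplus>\<^bsub>UA\<^esub> T u a'"
proof -
  have "T u a \<oplus>\<^bsub>UA\<^esub> T u a' = N #>\<^bsub>F\<^esub> (frag_of (u,a) + frag_of (u,a'))"
    unfolding pure_tensor_def by (rule cos_add) (use assms in \<open>auto\<close>)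
  also have "\<dots> = T u (a \<oplus>\<^bsub>A\<^esub> a')"
    unfolding pure_tensor_def
    by (rule cos_eq[symmetric]) (use assms rels_N[OF tensor_rels.add_right[OF assms(1) assms(3) assms(2)]] in \<open>simp_all add: diff_diff_eq keys_add2\<close>)
  finally show ?thesis by simp
qed

lemma T_bal: assumes "r \<in> carrier R" "u \<in> carrier U" "a \<in> carrier A"
  shows "T (r \<odot>\<^bsub>U\<^esub> u) a = T u (r \<odot>\<^bsub>A\<^esub> a)"
  unfolding pure_tensor_def
  by (rule cos_eq) (use assms rels_N[OF tensor_rels.balanced[OF assms]] in auto)

lemma universal:
  assumes G: "comm_group G"
    and f: "\<And>u a. u \<in> carrier U \<Longrightarrow> a \<in> carrier A \<Longrightarrow> f u a \<in> carrier G"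
    and l: "\<And>u u' a. \<lbrakk>u \<in> carrier U; u' \<in> carrier U; a \<in> carrier A\<rbrakk> \<Longrightarrow> f (u \<oplus>\<^bsub>U\<^esub> u') a = f u a \<otimes>\<^bsub>G\<^esub> f u' a"
    and r: "\<And>u a a'. \<lbrakk>u \<in> carrier U; a \<in> carrier A; a' \<in> carrier A\<rbrakk> \<Longrightarrow> f u (a \<oplus>\<^bsub>A\<^esub> a') = f u a \<otimes>\<^bsub>G\<^esub> f u a'"
    and b: "\<And>r u a. \<lbrakk>r \<in> carrier R; u \<in> carrier U; a \<in> carrier A\<rbrakk> \<Longrightarrow> f (r \<odot>\<^bsub>U\<^esub> u) a = f u (r \<odot>\<^bsub>A\<^esub> a)"
  obtains h where "h \<in> hom (F Mod N) G" "\<And>u a. u \<in> carrier U \<Longrightarrow> a \<in> carrier A \<Longrightarrow> h (T u a) = f u a"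
proof -
  interpret G: comm_group G by fact
  obtain k where k: "k \<in> hom F G" "\<And>x. x \<in> carrier U \<times> carrier A \<Longrightarrow> k (frag_of x) = case_prod f x"
    by (rule G.free_Abelian_group_universal[of "case_prod f" "carrier U \<times> carrier A"]) (use f in auto)
  interpret k: group_hom F G k
    using k(1) by (simp add: group_hom_def group_hom_axioms_def)
  have kd: "k (c - d) = k c \<otimes>\<^bsub>G\<^esub> inv\<^bsub>G\<^esub> k d" if "c \<in> carrier F" "d \<in> carrier F" for c d
    using k.hom_mult[of c "-d"] k.hom_inv[of d] that by simp
  have "tensor_rels R U A \<subseteq> kernel F G k"
  proof
    fix c assume c: "c \<in> tensor_rels R U A"
    then have "k c = \<one>\<^bsub>G\<^esub>"
    proof (induction)
      case (add_left u u' a)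
      then show ?case
        by (simp add: kd keys_diff2 k l f G.m_assoc G.m_comm G.m_lcomm flip: G.inv_mult)
    next
      case (add_right u a a')
      then show ?case
        by (simp add: kd keys_diff2 k r f G.m_assoc G.m_comm G.m_lcomm flip: G.inv_mult)
    next
      case (balanced r u a)
      then show ?case
        by (simp add: kd keys_diff2 k b f)
    qed
    with c rels_F show "c \<in> kernel F G k" by (auto simp: kernel_def simp del: carrier_free_Abelian_group_iff)
  qed
  then have "N \<subseteq> kernel F G k"
    unfolding tensor_null_def
    using group.generate_subgroup_incl[OF group_free_Abelian_group _ k.subgroup_kernel] by blast
  then obtain h where h: "h \<in> hom (F Mod N) G" "\<And>x. x \<in> carrier F \<Longrightarrow> h (N #>\<^bsub>F\<^esub> x) = k x"
    using k.FactGroup_universal_kernel[OF N_normal] by blast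
  show thesis
    by (rule that[OF h(1)]) (simp add: pure_tensor_def h(2) k(2))
qed

lemma induct_UA [consumes 1]:
  assumes s: "s \<in> carrier UA"
    and z: "P \<zero>\<^bsub>UA\<^esub>"
    and p: "\<And>u a. u \<in> carrier U \<Longrightarrow> a \<in> carrier A \<Longrightarrow> P (T u a)"
    and d: "\<And>s t. s \<in> carrier UA \<Longrightarrow> t \<in> carrier UA \<Longrightarrow> P s \<Longrightarrow> P t \<Longrightarrow> P (s \<ominus>\<^bsub>UA\<^esub> t)"
  shows "P s"
proof -
  interpret UA: abelian_group UA by (rule ag_UA)
  obtain c where c: "c \<in> carrier F" "s = N #>\<^bsub>F\<^esub> c" using cos_ex[OF s] .
  have N0: "N #>\<^bsub>F\<^esub> 0 = \<zero>\<^bsub>UA\<^esub>"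
    by (auto simp: UA_simps FactGroup_def r_coset_def)
  have "P (N #>\<^bsub>F\<^esub> c)"
  proof (rule free_Abelian_group_induct[of c "carrier U \<times> carrier A"])
    show "Poly_Mapping.keys c \<subseteq> carrier U \<times> carrier A" using c by simp
    show "P (N #>\<^bsub>F\<^esub> 0)" using z N0 by simp
    show "P (N #>\<^bsub>F\<^esub> frag_of x)" if "x \<in> carrier U \<times> carrier A" for x
      using p[of "fst x" "snd x"] that by (auto simp: pure_tensor_def)
    fix x y assume a: "Poly_Mapping.keys x \<subseteq> carrier U \<times> carrier A" "Poly_Mapping.keys y \<subseteq> carrier U \<times> carrier A"
      "P (N #>\<^bsub>F\<^esub> x)" "P (N #>\<^bsub>F\<^esub> y)"
    have "(N #>\<^bsub>F\<^esub> (x-y)) \<oplus>\<^bsub>UA\<^esub> (N #>\<^bsub>F\<^esub> y) = N #>\<^bsub>F\<^esub> x"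
      using cos_add[of "x - y" y] a by (simp add: keys_diff2)
    moreover have "N #>\<^bsub>F\<^esub> x \<in> carrier UA" "N #>\<^bsub>F\<^esub> y \<in> carrier UA" "N #>\<^bsub>F\<^esub> (x-y) \<in> carrier UA"
      using a by (simp_all add: cos_carr keys_diff2)
    ultimately have "N #>\<^bsub>F\<^esub> (x-y) = (N #>\<^bsub>F\<^esub> x) \<ominus>\<^bsub>UA\<^esub> (N #>\<^bsub>F\<^esub> y)"
      by (metis UA.add.inv_solve_right' a_minus_def)
    with d a show "P (N #>\<^bsub>F\<^esub> (x-y))"
      by (simp add: cos_carr)
  qed
  with c show ?thesis by simp
qed

lemma UA_ext:
  assumes G: "group G" and h: "h \<in> hom (add_monoid UA) G" "k \<in> hom (add_monoid UA) G"
    and p: "\<And>u a. u \<in> carrier U \<Longrightarrow> a \<in> carrier A \<Longrightarrow> h (T u a) = k (T u a)"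
    and s: "s \<in> carrier UA"
  shows "h s = k s"
proof -
  interpret UA: abelian_group UA by (rule ag_UA)
  interpret h: group_hom "add_monoid UA" G h
    using h(1) G UA.add.is_group by (simp add: group_hom_def group_hom_axioms_def)
  interpret k: group_hom "add_monoid UA" G k
    using h(2) G UA.add.is_group by (simp add: group_hom_def group_hom_axioms_def)
  from s show ?thesis
  proof (induction rule: induct_UA)
    case 1 then show ?case using h.hom_one k.hom_one by simp
  next
    case (2 u a) then show ?case by (rule p)
  next
    case (3 s t)
    have "h (s \<ominus>\<^bsub>UA\<^esub> t) = h s \<otimes>\<^bsub>G\<^esub> inv\<^bsub>G\<^esub> h t" 
      using 3 h.hom_mult[of s "\<ominus>\<^bsub>UA\<^esub> t"] h.hom_inv[of t] by (simp add: a_minus_def a_inv_def)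
    moreover have "k (s \<ominus>\<^bsub>UA\<^esub> t) = k s \<otimes>\<^bsub>G\<^esub> inv\<^bsub>G\<^esub> k t" 
      using 3 k.hom_mult[of s "\<ominus>\<^bsub>UA\<^esub> t"] k.hom_inv[of t] by (simp add: a_minus_def a_inv_def)
    ultimately show ?case using 3 by simp
  qed
qed

lemma homI2: "h \<in> hom (F Mod N) G \<longleftrightarrow> h \<in> hom (add_monoid UA) G"
  by (simp add: hom_def UA_simps)

lemma smult_N:
  assumes b: "b \<in> carrier A"
  shows "s \<in> carrier UA \<Longrightarrow> b \<odot>\<^bsub>UA\<^esub> s \<in> carrier UA"
    "s \<in> carrier UA \<Longrightarrow> t \<in> carrier UA \<Longrightarrow> b \<odot>\<^bsub>UA\<^esub> (s \<oplus>\<^bsub>UA\<^esub> t) = b \<odot>\<^bsub>UA\<^esub> s \<oplus>\<^bsub>UA\<^esub> b \<odot>\<^bsub>UA\<^esub> t"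
    "u \<in> carrier U \<Longrightarrow> a \<in> carrier A \<Longrightarrow> b \<odot>\<^bsub>UA\<^esub> T u a = T u (b \<otimes>\<^bsub>A\<^esub> a)"
proof -
  interpret F: comm_group F by (rule comm_F)
  interpret Ac: cring A by (rule A.M_cring)
  let ?e = "frag_extend (\<lambda>(u, a). frag_of (u, b \<otimes>\<^bsub>A\<^esub> a))"
  have eF: "?e c \<in> carrier F" if "c \<in> carrier F" for c
    using that keys_frag_extend[of "\<lambda>(u, a). frag_of (u, b \<otimes>\<^bsub>A\<^esub> a)" c] b
    by (fastforce simp: keys_frag_of)
  interpret e: group_hom F F ?e
    using eF by unfold_locales (auto simp: hom_def frag_extend_add)
  have "tensor_rels R U A \<subseteq> {c \<in> carrier F. ?e c \<in> N}"
  proof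
    fix c assume c: "c \<in> tensor_rels R U A"
    then have "?e c \<in> tensor_rels R U A"
    proof induction
      case (add_left u u' a)
      then show ?case using b tensor_rels.add_left[of u U u' "b \<otimes>\<^bsub>A\<^esub> a" A R] by (simp add: frag_extend_diff)
    next
      case (add_right u a a')
      then show ?case using b tensor_rels.add_right[of u U "b \<otimes>\<^bsub>A\<^esub> a" A "b \<otimes>\<^bsub>A\<^esub> a'" R]
        by (simp add: frag_extend_diff A.r_distr)
    next
      case (balanced r u a)
      have "b \<otimes>\<^bsub>A\<^esub> (r \<odot>\<^bsub>A\<^esub> a) = r \<odot>\<^bsub>A\<^esub> (b \<otimes>\<^bsub>A\<^esub> a)"
        using A.smult_assoc2[of r a b] balanced b A.m_comm by simp
      then show ?case using balanced b tensor_rels.balanced[of r R u U "b \<otimes>\<^bsub>A\<^esub> a" A]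
        by (simp add: frag_extend_diff)
    qed
    with c rels_F rels_N show "c \<in> {c \<in> carrier F. ?e c \<in> N}" by blast
  qed
  moreover have "subgroup {c \<in> carrier F. ?e c \<in> N} F"
  proof -
    interpret Ns: subgroup N F by (rule N_sub)
    show ?thesis
      by (rule F.subgroupI) (use Ns.m_closed Ns.m_inv_closed Ns.one_closed e.hom_inv e.hom_mult F.one_closed F.inv_closed F.m_closed e.hom_one in \<open>force simp del: carrier_free_Abelian_group_iff mult_free_Abelian_group one_free_Abelian_group inv_free_Abelian_group\<close>)+
  qed
  ultimately have eN: "?e c \<in> N" if "c \<in> N" for c
    using that F.generate_subgroup_incl unfolding tensor_null_def by blast
  have key: "b \<odot>\<^bsub>UA\<^esub> (N #>\<^bsub>F\<^esub> c) = N #>\<^bsub>F\<^esub> ?e c" if c: "c \<in> carrier F" for c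
  proof -
    have N0: "0 \<in> N" using subgroup.one_closed[OF N_sub] by simp
    have Nadd: "x + y \<in> N" if "x \<in> N" "y \<in> N" for x y using subgroup.m_closed[OF N_sub that] by simp
    have "b \<odot>\<^bsub>UA\<^esub> (N #>\<^bsub>F\<^esub> c) = {n + ?e (n' + c) |n n'. n \<in> N \<and> n' \<in> N}"
      by (auto simp: UA_simps set_mult_def r_coset_def; blast)
    also have "\<dots> = {n + ?e c |n. n \<in> N}"
    proof safe
      fix n n' assume "n \<in> N" "n' \<in> N"
      then show "\<exists>na. n + ?e (n' + c) = na + ?e c \<and> na \<in> N"
        by (intro exI[of _ "n + ?e n'"]) (simp add: frag_extend_add add.assoc Nadd eN)
    next
      fix n assume "n \<in> N"
      then show "\<exists>na n'. n + ?e c = na + ?e (n' + c) \<and> na \<in> N \<and> n' \<in> N"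
        by (intro exI[of _ n] exI[of _ 0]) (simp add: N0)
    qed
    also have "\<dots> = N #>\<^bsub>F\<^esub> ?e c" by (auto simp: r_coset_def)
    finally show ?thesis .
  qed
  show "b \<odot>\<^bsub>UA\<^esub> s \<in> carrier UA" if st: "s \<in> carrier UA"
  proof -
    obtain c where c: "c \<in> carrier F" "s = N #>\<^bsub>F\<^esub> c" using cos_ex[OF st] .
    show ?thesis by (simp only: c key cos_carr eF)
  qed
  show "b \<odot>\<^bsub>UA\<^esub> (s \<oplus>\<^bsub>UA\<^esub> t) = b \<odot>\<^bsub>UA\<^esub> s \<oplus>\<^bsub>UA\<^esub> b \<odot>\<^bsub>UA\<^esub> t" if st: "s \<in> carrier UA" "t \<in> carrier UA"
  proof -
    obtain c where c: "c \<in> carrier F" "s = N #>\<^bsub>F\<^esub> c" using cos_ex[OF st(1)] .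
    obtain d where d: "d \<in> carrier F" "t = N #>\<^bsub>F\<^esub> d" using cos_ex[OF st(2)] .
    show ?thesis
      using cos_add[OF eF[OF c(1)] eF[OF d(1)]] by (simp only: c d cos_add key F_add frag_extend_add)
  qed
  show "b \<odot>\<^bsub>UA\<^esub> T u a = T u (b \<otimes>\<^bsub>A\<^esub> a)" if "u \<in> carrier U" "a \<in> carrier A"
    unfolding pure_tensor_def using that by (subst key) auto
qed

lemma module_UA: "module A UA"
proof -
  interpret UA: abelian_group UA by (rule ag_UA)
  interpret Ac: cring A by (rule A.M_cring)
  note am = UA.add.is_group
  have hs: "(\<lambda>s. b \<odot>\<^bsub>UA\<^esub> s) \<in> hom (add_monoid UA) (add_monoid UA)" if "b \<in> carrier A" for b
    by (auto simp: hom_def smult_N[OF that])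
  have hs2: "(\<lambda>s. b \<odot>\<^bsub>UA\<^esub> (c \<odot>\<^bsub>UA\<^esub> s)) \<in> hom (add_monoid UA) (add_monoid UA)" if "b \<in> carrier A" "c \<in> carrier A" for b c
    by (auto simp: hom_def smult_N[OF that(1)] smult_N[OF that(2)])
  have hs3: "(\<lambda>s. b \<odot>\<^bsub>UA\<^esub> s \<oplus>\<^bsub>UA\<^esub> c \<odot>\<^bsub>UA\<^esub> s) \<in> hom (add_monoid UA) (add_monoid UA)" if "b \<in> carrier A" "c \<in> carrier A" for b c
    by (auto simp: hom_def smult_N[OF that(1)] smult_N[OF that(2)] UA.a_ac)
  have hid: "(\<lambda>s. s) \<in> hom (add_monoid UA) (add_monoid UA)" by (auto simp: hom_def)
  show ?thesis
  proof (rule moduleI[OF A.M_cring ag_UA])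
    fix a b x assume P: "a \<in> carrier A" "b \<in> carrier A" "x \<in> carrier UA"
    show "(a \<oplus>\<^bsub>A\<^esub> b) \<odot>\<^bsub>UA\<^esub> x = a \<odot>\<^bsub>UA\<^esub> x \<oplus>\<^bsub>UA\<^esub> b \<odot>\<^bsub>UA\<^esub> x"
      by (rule UA_ext[OF am hs hs3]) (use P in \<open>auto simp: smult_N(3) T_add_right A.l_distr\<close>)
  next
    fix a b x assume P: "a \<in> carrier A" "b \<in> carrier A" "x \<in> carrier UA"
    show "(a \<otimes>\<^bsub>A\<^esub> b) \<odot>\<^bsub>UA\<^esub> x = a \<odot>\<^bsub>UA\<^esub> (b \<odot>\<^bsub>UA\<^esub> x)"
      by (rule UA_ext[OF am hs hs2]) (use P in \<open>auto simp: smult_N(3) A.m_assoc\<close>)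
  next
    fix x assume P: "x \<in> carrier UA"
    show "\<one>\<^bsub>A\<^esub> \<odot>\<^bsub>UA\<^esub> x = x"
      by (rule UA_ext[OF am hs hid]) (use P in \<open>auto simp: smult_N(3)\<close>)
  qed (auto simp: smult_N)
qed

end

lemma mod_hom_imp_hom:
  assumes "f \<in> mod_hom R V W" shows "f \<in> hom (add_monoid V) (add_monoid W)"
  using mod_homD[OF assms] by (auto simp: hom_def)

lemma (in base_change_setup) mod_hom_eqI:
  assumes W: "module A W" and f: "f \<in> mod_hom A UA W" "g \<in> mod_hom A UA W"
    and p: "\<And>u a. u \<in> carrier U \<Longrightarrow> a \<in> carrier A \<Longrightarrow> f (T u a) = g (T u a)"
  shows "f = g"
proof (rule extensionalityI[OF mod_homD(4)[OF f(1)] mod_homD(4)[OF f(2)]])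
  interpret W: module A W by fact
  fix s assume "s \<in> carrier UA"
  from this p show "f s = g s"
    using UA_ext[OF W.M.add.is_group mod_hom_imp_hom[OF f(1)] mod_hom_imp_hom[OF f(2)]] by blast
qed

text \<open>A balanced map that is \<open>A\<close>-linear in the second argument induces an \<open>A\<close>-linear map.\<close>

lemma (in base_change_setup) universal_linear:
  assumes W: "module A W"
    and f: "\<And>u a. u \<in> carrier U \<Longrightarrow> a \<in> carrier A \<Longrightarrow> f u a \<in> carrier W"
    and l: "\<And>u u' a. \<lbrakk>u \<in> carrier U; u' \<in> carrier U; a \<in> carrier A\<rbrakk> \<Longrightarrow> f (u \<oplus>\<^bsub>U\<^esub> u') a = f u a \<oplus>\<^bsub>W\<^esub> f u' a"
    and r: "\<And>u a a'. \<lbrakk>u \<in> carrier U; a \<in> carrier A; a' \<in> carrier A\<rbrakk> \<Longrightarrow> f u (a \<oplus>\<^bsub>A\<^esub> a') = f u a \<oplus>\<^bsub>W\<^esub> f u a'"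
    and b: "\<And>r u a. \<lbrakk>r \<in> carrier R; u \<in> carrier U; a \<in> carrier A\<rbrakk> \<Longrightarrow> f (r \<odot>\<^bsub>U\<^esub> u) a = f u (r \<odot>\<^bsub>A\<^esub> a)"
    and s: "\<And>u a c. \<lbrakk>u \<in> carrier U; a \<in> carrier A; c \<in> carrier A\<rbrakk> \<Longrightarrow> f u (c \<otimes>\<^bsub>A\<^esub> a) = c \<odot>\<^bsub>W\<^esub> f u a"
  shows "\<exists>h. h \<in> mod_hom A UA W \<and> (\<forall>u\<in>carrier U. \<forall>a\<in>carrier A. h (T u a) = f u a)"
proof -
  interpret W: module A W by fact
  interpret UA: module A UA by (rule module_UA)
  obtain h where h0: "h \<in> hom (F Mod N) (add_monoid W)"
    and hT: "\<And>u a. u \<in> carrier U \<Longrightarrow> a \<in> carrier A \<Longrightarrow> h (T u a) = f u a"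
    by (rule universal[of "add_monoid W" f]) (use f l r b W.M.a_comm_group in \<open>auto\<close>)
  have h: "h \<in> hom (add_monoid UA) (add_monoid W)" using h0 homI2 by blast
  have hc: "h x \<in> carrier W" if "x \<in> carrier UA" for x using h that by (auto simp: hom_def)
  have ha: "h (x \<oplus>\<^bsub>UA\<^esub> y) = h x \<oplus>\<^bsub>W\<^esub> h y" if "x \<in> carrier UA" "y \<in> carrier UA" for x y
    using h that by (auto simp: hom_def)
  have hs: "h (c \<odot>\<^bsub>UA\<^esub> x) = c \<odot>\<^bsub>W\<^esub> h x" if c: "c \<in> carrier A" and x: "x \<in> carrier UA" for c x
  proof (rule UA_ext[OF W.M.add.is_group _ _ _ x])
    show "(\<lambda>x. h (c \<odot>\<^bsub>UA\<^esub> x)) \<in> hom (add_monoid UA) (add_monoid W)"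
      "(\<lambda>x. c \<odot>\<^bsub>W\<^esub> h x) \<in> hom (add_monoid UA) (add_monoid W)"
      using c by (auto simp: hom_def hc ha UA.smult_r_distr W.smult_r_distr)
    show "h (c \<odot>\<^bsub>UA\<^esub> T u a) = c \<odot>\<^bsub>W\<^esub> h (T u a)" if "u \<in> carrier U" "a \<in> carrier A" for u a
      using that c by (simp add: smult_N hT s)
  qed
  show ?thesis
    by (rule exI[of _ "restrict h (carrier UA)"])
      (auto intro!: mod_homI simp: hc ha hs hT T_carr)
qed

theorem ex1_change_of_scalars:
  assumes rep: "module_rep R M V W \<theta>" and A: "algebra R A"
  shows "\<exists>!\<Theta>. is_change_of_scalars R A M V W \<theta> \<Theta>"
proof -
  have mods: "module R M" "module R V" "module R W" and th: "\<theta> \<in> mod_hom R M (hom_module R V W)"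
    using rep by (auto simp: module_rep_def)
  interpret M: base_change_setup R M A using mods A by (simp add: base_change_setup_def)
  interpret V: base_change_setup R V A using mods A by (simp add: base_change_setup_def)
  interpret W: base_change_setup R W A using mods A by (simp add: base_change_setup_def)
  interpret WA: module A W.UA by (rule W.module_UA)
  let ?H = "hom_module A V.UA W.UA"
  have modH: "module A ?H" by (rule module_hom_module[OF V.module_UA W.module_UA])
  have th1: "\<theta> m \<in> mod_hom R V W" if "m \<in> carrier M" for m
    using mod_homD(1)[OF th that] by simp
  note D = mod_homD[OF th1]
  have tha: "\<theta> (m \<oplus>\<^bsub>M\<^esub> m') x = \<theta> m x \<oplus>\<^bsub>W\<^esub> \<theta> m' x" if "m \<in> carrier M" "m' \<in> carrier M" "x \<in> carrier V" for m m' x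
    using mod_homD(2)[OF th that(1,2)] that by simp
  have ths: "\<theta> (r \<odot>\<^bsub>M\<^esub> m) x = r \<odot>\<^bsub>W\<^esub> \<theta> m x" if "m \<in> carrier M" "r \<in> carrier R" "x \<in> carrier V" for m r x
    using mod_homD(3)[OF th that(2,1)] that by simp
  have sm: "c \<otimes>\<^bsub>A\<^esub> (r \<odot>\<^bsub>A\<^esub> a) = r \<odot>\<^bsub>A\<^esub> (c \<otimes>\<^bsub>A\<^esub> a)" "(r \<odot>\<^bsub>A\<^esub> a) \<otimes>\<^bsub>A\<^esub> c = r \<odot>\<^bsub>A\<^esub> (a \<otimes>\<^bsub>A\<^esub> c)"
    if "c \<in> carrier A" "a \<in> carrier A" "r \<in> carrier R" for c a r
    using that M.A.smult_assoc2[of r a c] M.A.m_comm[of c "r \<odot>\<^bsub>A\<^esub> a"] M.A.m_comm[of c a] by auto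
  have "\<exists>h. h \<in> mod_hom A V.UA W.UA \<and>
      (\<forall>x\<in>carrier V. \<forall>b\<in>carrier A. h (V.T x b) = W.T (\<theta> m x) (b \<otimes>\<^bsub>A\<^esub> a))"
    if "m \<in> carrier M" "a \<in> carrier A" for m a
    by (rule V.universal_linear[OF W.module_UA])
      (use that in \<open>simp_all add: D W.T_carr W.T_add_left W.T_add_right M.A.l_distr W.T_bal sm W.smult_N(3) M.A.m_assoc\<close>)
  then obtain g where g: "\<And>m a. m \<in> carrier M \<Longrightarrow> a \<in> carrier A \<Longrightarrow> g m a \<in> mod_hom A V.UA W.UA"
    and gT: "\<And>m a x b. \<lbrakk>m \<in> carrier M; a \<in> carrier A; x \<in> carrier V; b \<in> carrier A\<rbrakk> \<Longrightarrow>
      g m a (V.T x b) = W.T (\<theta> m x) (b \<otimes>\<^bsub>A\<^esub> a)"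
    by metis
  note Hc = module.smult_closed[OF modH, unfolded hom_module_simps(1)]
    abelian_groupE(1)[OF module.axioms(2)[OF modH], unfolded hom_module_simps(1)]
  have "\<exists>\<Theta>. \<Theta> \<in> mod_hom A M.UA ?H \<and> (\<forall>m\<in>carrier M. \<forall>a\<in>carrier A. \<Theta> (M.T m a) = g m a)"
  proof (rule M.universal_linear[OF modH])
    show "g m a \<in> carrier ?H" if "m \<in> carrier M" "a \<in> carrier A" for m a using g that by simp
    show "g (m \<oplus>\<^bsub>M\<^esub> m') a = g m a \<oplus>\<^bsub>?H\<^esub> g m' a" if "m \<in> carrier M" "m' \<in> carrier M" "a \<in> carrier A" for m m' a
      by (rule V.mod_hom_eqI[OF W.module_UA])
        (use that in \<open>simp_all add: g Hc gT tha V.T_carr W.T_add_left D del: hom_module_simps(3,4)\<close>, 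
          simp_all add: gT V.T_carr D W.T_add_left that)
    show "g m (a \<oplus>\<^bsub>A\<^esub> a') = g m a \<oplus>\<^bsub>?H\<^esub> g m a'" if "m \<in> carrier M" "a \<in> carrier A" "a' \<in> carrier A" for m a a'
      by (rule V.mod_hom_eqI[OF W.module_UA])
        (use that in \<open>simp_all add: g Hc gT del: hom_module_simps(3,4)\<close>,
          simp_all add: gT V.T_carr D W.T_add_right M.A.r_distr that)
    show "g (r \<odot>\<^bsub>M\<^esub> m) a = g m (r \<odot>\<^bsub>A\<^esub> a)" if "r \<in> carrier R" "m \<in> carrier M" "a \<in> carrier A" for r m a
      by (rule V.mod_hom_eqI[OF W.module_UA])
        (use that in \<open>simp_all add: g gT ths W.T_bal D sm\<close>)
    show "g m (c \<otimes>\<^bsub>A\<^esub> a) = c \<odot>\<^bsub>?H\<^esub> g m a" if "m \<in> carrier M" "a \<in> carrier A" "c \<in> carrier A" for m a c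
      by (rule V.mod_hom_eqI[OF W.module_UA])
        (use that in \<open>simp_all add: g Hc gT del: hom_module_simps(3,4)\<close>,
          simp_all add: gT V.T_carr D W.smult_N(3) M.A.m_lcomm that)
  qed
  then obtain \<Theta> where Th: "\<Theta> \<in> mod_hom A M.UA ?H" "\<And>m a. m \<in> carrier M \<Longrightarrow> a \<in> carrier A \<Longrightarrow> \<Theta> (M.T m a) = g m a"
    by blast
  show ?thesis
  proof (rule ex1I)
    show "is_change_of_scalars R A M V W \<theta> \<Theta>"
      using Th by (simp add: is_change_of_scalars_def module_rep_def M.module_UA V.module_UA W.module_UA rep_mult_def gT)
  next
    fix \<Xi> assume "is_change_of_scalars R A M V W \<theta> \<Xi>"
    then have X: "\<Xi> \<in> mod_hom A M.UA ?H"
      and XT: "\<And>m a x b. \<lbrakk>m \<in> carrier M; a \<in> carrier A; x \<in> carrier V; b \<in> carrier A\<rbrakk> \<Longrightarrow>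
        \<Xi> (M.T m a) (V.T x b) = W.T (\<theta> m x) (b \<otimes>\<^bsub>A\<^esub> a)"
      by (auto simp: is_change_of_scalars_def module_rep_def rep_mult_def)
    show "\<Xi> = \<Theta>"
    proof (rule M.mod_hom_eqI[OF modH X Th(1)])
      fix m a assume ma: "m \<in> carrier M" "a \<in> carrier A"
      show "\<Xi> (M.T m a) = \<Theta> (M.T m a)"
        by (rule V.mod_hom_eqI[OF W.module_UA])
          (use ma mod_homD(1)[OF X M.T_carr] g in \<open>simp_all add: Th(2) XT gT\<close>)
    qed
  qed
qed

corollary change_of_scalars:
  assumes "module_rep R M V W \<theta>" "algebra R A"
  shows "is_change_of_scalars R A M V W \<theta> (change_of_scalars R A M V W \<theta>)"
  unfolding change_of_scalars_def by (rule theI'[OF ex1_change_of_scalars[OF assms]])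

end

theory Submission
  imports Defs
begin

text \<open>
  The proof counts commuting pairs. By the Burnside lemma applied to conjugation, a finite group
  \<open>G\<close> satisfies \<open>k(G) |G| = \<Sum>g. |C(g)|\<close> (\<open>conj_class_number_centralizers\<close>). In a group on
  \<open>M \<times> W\<close> with multiplication \<open>(a, y) (b, z) = (a + b, y + z + \<beta> a b)\<close>, two elements commute iff
  \<open>\<beta> a b = \<beta> b a\<close>, a condition that ignores \<open>y\<close> and \<open>z\<close>. If \<open>\<beta>\<close> is alternating, then it is
  antisymmetric, so the condition reads \<open>2 (\<beta> b a) = 0\<close>; that is, \<open>b\<close> lies in the kernel
  \<open>K a\<close> of \<open>x \<mapsto> 2 (\<beta> x a)\<close>. Hence the centralizer of \<open>(a, y)\<close> is \<open>K a \<times> W\<close>, and the sum of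
  the sizes of all centralizers is \<open>|W|\<^sup>2 (\<Sum>a. |K a|)\<close>. Division by \<open>|G| = |M| |W|\<close> leaves
  \<open>|W|\<close> times the average size of \<open>K a\<close> (\<open>conj_class_number_extension\<close>).

  What this argument needs to know about tensor products is that the change of scalars \<open>\<alpha>\<^sup>A\<close> is again
  alternating (\<open>change_of_scalars_alternating\<close>). Since not every element of \<open>M\<^sub>A\<close> is a pure
  tensor, this is shown in two stages: antisymmetry is biadditive and therefore passes from pure
  tensors to all of \<open>M\<^sub>A\<close>; antisymmetry then makes \<open>s \<mapsto> s * s\<close> additive, so that it too is
  determined by pure tensors.
\<close>


section \<open>Conjugacy classes and centralizers\<close>

lemma (in group) conj_fixes_iff_commute:
  assumes "g \<in> carrier G" "h \<in> carrier G"
  shows "g \<otimes> h \<otimes> inv g = h \<longleftrightarrow> g \<otimes> h = h \<otimes> g"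
  using assms by (metis inv_solve_right m_closed)

lemma (in group) conj_class_number_centralizers:
  assumes "finite (carrier G)"
  shows "conj_class_number G * order G =
    (\<Sum>g\<in>carrier G. card {h \<in> carrier G. g \<otimes> h = h \<otimes> g})"
proof -
  let ?\<phi> = "\<lambda>g. \<lambda>h\<in>carrier G. g \<otimes> h \<otimes> inv g"
  have "conj_class_number G * order G = (\<Sum>g\<in>carrier G. card (invariants (carrier G) ?\<phi> g))"
    unfolding conj_class_number_def
    by (rule group_action.burnside[OF action_by_conjugation assms assms])
  also have "\<dots> = (\<Sum>g\<in>carrier G. card {h \<in> carrier G. g \<otimes> h = h \<otimes> g})"
    by (intro sum.cong refl arg_cong[of _ _ card])
      (auto simp: invariants_def conj_fixes_iff_commute)
  finally show ?thesis .
qed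


section \<open>The group of an alternating biadditive map\<close>

locale alternating_biadditive = M: abelian_group M + W: abelian_group W
  for M :: "('m, 'y) ring_scheme" and W :: "('w, 'z) ring_scheme" +
  fixes \<beta> :: "'m \<Rightarrow> 'm \<Rightarrow> 'w"
  assumes closed: "\<lbrakk>a \<in> carrier M; b \<in> carrier M\<rbrakk> \<Longrightarrow> \<beta> a b \<in> carrier W"
    and add_left: "\<lbrakk>a \<in> carrier M; a' \<in> carrier M; b \<in> carrier M\<rbrakk> \<Longrightarrow>
      \<beta> (a \<oplus>\<^bsub>M\<^esub> a') b = \<beta> a b \<oplus>\<^bsub>W\<^esub> \<beta> a' b"
    and add_right: "\<lbrakk>a \<in> carrier M; b \<in> carrier M; b' \<in> carrier M\<rbrakk> \<Longrightarrow>
      \<beta> a (b \<oplus>\<^bsub>M\<^esub> b') = \<beta> a b \<oplus>\<^bsub>W\<^esub> \<beta> a b'"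
    and alternating: "a \<in> carrier M \<Longrightarrow> \<beta> a a = \<zero>\<^bsub>W\<^esub>"
begin

definition extension :: "('m \<times> 'w) monoid"
  where "extension =
    \<lparr>carrier = carrier M \<times> carrier W,
     monoid.mult = (\<lambda>(a, y) (a', y'). (a \<oplus>\<^bsub>M\<^esub> a', y \<oplus>\<^bsub>W\<^esub> y' \<oplus>\<^bsub>W\<^esub> \<beta> a a')),
     one = (\<zero>\<^bsub>M\<^esub>, \<zero>\<^bsub>W\<^esub>)\<rparr>"

lemma antisym:
  assumes "a \<in> carrier M" "b \<in> carrier M"
  shows "\<beta> a b \<oplus>\<^bsub>W\<^esub> \<beta> b a = \<zero>\<^bsub>W\<^esub>"
proof -
  have "\<zero>\<^bsub>W\<^esub> = \<beta> (a \<oplus>\<^bsub>M\<^esub> b) (a \<oplus>\<^bsub>M\<^esub> b)"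
    using assms by (simp add: alternating)
  also have "\<dots> = (\<beta> a a \<oplus>\<^bsub>W\<^esub> \<beta> a b) \<oplus>\<^bsub>W\<^esub> (\<beta> b a \<oplus>\<^bsub>W\<^esub> \<beta> b b)"
    using assms by (subst add_left) (simp_all add: add_right)
  also have "\<dots> = \<beta> a b \<oplus>\<^bsub>W\<^esub> \<beta> b a"
    using assms by (simp add: closed alternating)
  finally show ?thesis by simp
qed

lemma zero_left: "b \<in> carrier M \<Longrightarrow> \<beta> \<zero>\<^bsub>M\<^esub> b = \<zero>\<^bsub>W\<^esub>"
  using add_left[of "\<zero>\<^bsub>M\<^esub>" "\<zero>\<^bsub>M\<^esub>" b] closed[of "\<zero>\<^bsub>M\<^esub>" b] by simp

lemma minus_left:
  assumes "a \<in> carrier M" "b \<in> carrier M"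
  shows "\<beta> (\<ominus>\<^bsub>M\<^esub> a) b = \<ominus>\<^bsub>W\<^esub> \<beta> a b"
  using add_left[of "\<ominus>\<^bsub>M\<^esub> a" a b] assms zero_left[of b]
  by (simp add: M.l_neg closed W.minus_equality)

lemma group_extension: "group extension"
proof (rule groupI)
  fix g assume "g \<in> carrier extension"
  then obtain a y where g: "g = (a, y)" "a \<in> carrier M" "y \<in> carrier W"
    by (auto simp: extension_def)
  \<comment> \<open>As \<open>\<beta> a a = 0\<close>, the twist does not enter the inverse.\<close>
  then show "\<exists>h\<in>carrier extension. h \<otimes>\<^bsub>extension\<^esub> g = \<one>\<^bsub>extension\<^esub>"
    by (intro bexI[of _ "(\<ominus>\<^bsub>M\<^esub> a, \<ominus>\<^bsub>W\<^esub> y)"])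
      (auto simp: extension_def M.l_neg W.l_neg minus_left alternating)
qed (auto simp: extension_def M.a_ac W.a_ac closed add_left add_right zero_left)

text \<open>Modulo the commutative additions, the two products differ in \<open>\<beta> a b\<close> and
  \<open>\<beta> b a = \<ominus> \<beta> a b\<close> only. The roles of \<open>a\<close> and \<open>b\<close> in the right-hand side are arranged so
  that, for fixed \<open>a\<close>, it is the kernel of a map on \<open>M\<close>.\<close>

lemma commute_iff:
  assumes "a \<in> carrier M" "b \<in> carrier M" "y \<in> carrier W" "z \<in> carrier W"
  shows "(a, y) \<otimes>\<^bsub>extension\<^esub> (b, z) = (b, z) \<otimes>\<^bsub>extension\<^esub> (a, y)
    \<longleftrightarrow> \<beta> b a \<oplus>\<^bsub>W\<^esub> \<beta> b a = \<zero>\<^bsub>W\<^esub>"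
proof -
  have "\<beta> b a = \<ominus>\<^bsub>W\<^esub> \<beta> a b"
    using antisym[of b a] assms by (simp add: closed W.minus_equality)
  then have "\<beta> a b = \<beta> b a \<longleftrightarrow> \<beta> b a \<oplus>\<^bsub>W\<^esub> \<beta> b a = \<zero>\<^bsub>W\<^esub>"
    using assms by (metis W.add.inv_closed W.minus_equality W.minus_minus W.r_neg closed)
  then show ?thesis
    using assms W.a_comm[of z y] M.a_comm[of b a] by (simp add: extension_def closed)
qed

theorem conj_class_number_extension:
  assumes "finite (carrier M)" "finite (carrier W)"
  shows "conj_class_number extension * card (carrier M) = card (carrier W) *
    (\<Sum>a\<in>carrier M. card {b \<in> carrier M. \<beta> b a \<oplus>\<^bsub>W\<^esub> \<beta> b a = \<zero>\<^bsub>W\<^esub>})"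
proof -
  interpret G: group extension by (rule group_extension)
  let ?K = "\<lambda>a. {b \<in> carrier M. \<beta> b a \<oplus>\<^bsub>W\<^esub> \<beta> b a = \<zero>\<^bsub>W\<^esub>}"
  have carr: "carrier extension = carrier M \<times> carrier W"
    by (simp add: extension_def)
  have "{h \<in> carrier extension. (a, y) \<otimes>\<^bsub>extension\<^esub> h = h \<otimes>\<^bsub>extension\<^esub> (a, y)} = ?K a \<times> carrier W"
    if "a \<in> carrier M" "y \<in> carrier W" for a y
    using that by (auto simp: carr commute_iff)
  then have "conj_class_number extension * order extension =
      (\<Sum>(a, y)\<in>carrier M \<times> carrier W. card (?K a) * card (carrier W))"
    using G.conj_class_number_centralizers assms
    by (auto simp: carr card_cartesian_product intro!: sum.cong)
  also have "\<dots> = card (carrier W) * (card (carrier W) * (\<Sum>a\<in>carrier M. card (?K a)))"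
    by (simp add: sum.cartesian_product[symmetric] sum_distrib_left mult.commute mult.left_commute)
  finally have "card (carrier W) * (conj_class_number extension * card (carrier M)) =
      card (carrier W) * (card (carrier W) * (\<Sum>a\<in>carrier M. card (?K a)))"
    by (simp add: order_def carr card_cartesian_product mult.commute mult.left_commute)
  moreover have "card (carrier W) > 0"
    using assms W.zero_closed by (auto simp: card_gt_0_iff)
  ultimately show ?thesis by simp
qed

end


section \<open>Change of scalars of an alternating module representation\<close>

lemma module_rep_closed:
  assumes "module_rep R M V W \<theta>" "a \<in> carrier M" "x \<in> carrier V"
  shows "\<theta> a x \<in> carrier W"
  using assms mod_homD(1)[of \<theta> R M "hom_module R V W" a] mod_homD(1)[of "\<theta> a" R V W x]
  by (simp add: module_rep_def)

lemma module_rep_add_right: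
  assumes "module_rep R M V W \<theta>" "a \<in> carrier M" "b \<in> carrier M" "x \<in> carrier V"
  shows "\<theta> (a \<oplus>\<^bsub>M\<^esub> b) x = \<theta> a x \<oplus>\<^bsub>W\<^esub> \<theta> b x"
  using assms mod_homD(2)[of \<theta> R M "hom_module R V W" a b] by (simp add: module_rep_def)

lemma module_rep_add_left:
  assumes "module_rep R M V W \<theta>" "a \<in> carrier M" "x \<in> carrier V" "y \<in> carrier V"
  shows "\<theta> a (x \<oplus>\<^bsub>V\<^esub> y) = \<theta> a x \<oplus>\<^bsub>W\<^esub> \<theta> a y"
  using assms mod_homD(1)[of \<theta> R M "hom_module R V W" a] mod_homD(2)[of "\<theta> a" R V W x y]
  by (simp add: module_rep_def)

lemma alternating_rep_biadditive:
  assumes "alternating_rep R M W \<alpha>"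
  shows "alternating_biadditive M W (rep_mult \<alpha>)"
proof -
  have rep: "module_rep R M M W \<alpha>" and alt: "\<And>a. a \<in> carrier M \<Longrightarrow> rep_mult \<alpha> a a = \<zero>\<^bsub>W\<^esub>"
    using assms by (auto simp: alternating_rep_def)
  interpret M: module R M using rep by (simp add: module_rep_def)
  interpret W: module R W using rep by (simp add: module_rep_def)
  show ?thesis
    by unfold_locales
      (simp_all add: rep_mult_def module_rep_closed[OF rep] module_rep_add_left[OF rep]
        module_rep_add_right[OF rep] alt[unfolded rep_mult_def])
qed

text \<open>On pure tensors, \<open>(m \<otimes> a) * (m \<otimes> a) = (m * m) \<otimes> a\<^sup>2 = 0\<close>. To reach sums of pure tensors,
  the mixed terms \<open>s * t + t * s\<close> have to vanish as well; this expression is additive in \<open>s\<close> and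
  in \<open>t\<close>, and for pure tensors it is \<open>(m * n + n * m) \<otimes> a b = 0\<close>.\<close>

theorem change_of_scalars_alternating:
  assumes alt: "alternating_rep R M W \<alpha>" and A: "algebra R A"
  shows "alternating_rep A (base_change R A M) (base_change R A W) (change_of_scalars R A M M W \<alpha>)"
proof -
  let ?B = "change_of_scalars R A M M W \<alpha>"
  interpret \<alpha>: alternating_biadditive M W "rep_mult \<alpha>"
    by (rule alternating_rep_biadditive[OF alt])
  have rep0: "module_rep R M M W \<alpha>" using alt by (simp add: alternating_rep_def)
  interpret M: base_change_setup R M A
    using rep0 A by (simp add: module_rep_def base_change_setup_def)
  interpret W: base_change_setup R W A
    using rep0 A by (simp add: module_rep_def base_change_setup_def)
  interpret MA: module A M.UA by (rule M.module_UA)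
  interpret WA: module A W.UA by (rule W.module_UA)
  have B: "is_change_of_scalars R A M M W \<alpha> ?B" by (rule change_of_scalars[OF rep0 A])
  have rep: "module_rep A M.UA M.UA W.UA ?B" using B by (simp add: is_change_of_scalars_def)
  have pure: "?B (M.T m a) (M.T n b) = W.T (rep_mult \<alpha> n m) (b \<otimes>\<^bsub>A\<^esub> a)"
    if "m \<in> carrier M" "a \<in> carrier A" "n \<in> carrier M" "b \<in> carrier A" for m a n b
    using B that unfolding is_change_of_scalars_def rep_mult_def by blast
  have T0: "W.T \<zero>\<^bsub>W\<^esub> c = \<zero>\<^bsub>W.UA\<^esub>" if "c \<in> carrier A" for c
    using W.T_add_left[of "\<zero>\<^bsub>W\<^esub>" "\<zero>\<^bsub>W\<^esub>" c] W.T_carr[of "\<zero>\<^bsub>W\<^esub>" c] that by simp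
  note [simp] = module_rep_closed[OF rep] module_rep_add_left[OF rep] module_rep_add_right[OF rep]
    M.T_carr
  have anti_pure: "?B (M.T m a) (M.T n b) \<oplus>\<^bsub>W.UA\<^esub> ?B (M.T n b) (M.T m a) = \<zero>\<^bsub>W.UA\<^esub>"
    if "m \<in> carrier M" "a \<in> carrier A" "n \<in> carrier M" "b \<in> carrier A" for m a n b
    using that W.T_add_left[of "rep_mult \<alpha> n m" "rep_mult \<alpha> m n" "b \<otimes>\<^bsub>A\<^esub> a"]
    by (simp add: pure \<alpha>.closed \<alpha>.antisym T0 M.A.m_comm[of a b])
  have hom1: "(\<lambda>s. ?B s t \<oplus>\<^bsub>W.UA\<^esub> ?B t s) \<in> hom (add_monoid M.UA) (add_monoid W.UA)"
    if "t \<in> carrier M.UA" for t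
    using that by (auto simp: hom_def WA.a_ac)
  have hom0: "(\<lambda>s. \<zero>\<^bsub>W.UA\<^esub>) \<in> hom (add_monoid M.UA) (add_monoid W.UA)"
    by (auto simp: hom_def)
  note ext = M.UA_ext[OF WA.add.is_group hom1 hom0]
  have anti: "?B s t \<oplus>\<^bsub>W.UA\<^esub> ?B t s = \<zero>\<^bsub>W.UA\<^esub>" if s: "s \<in> carrier M.UA" and t: "t \<in> carrier M.UA" for s t
  proof (rule ext[OF t _ s])
    fix m a assume ma: "m \<in> carrier M" "a \<in> carrier A"
    have "?B t (M.T m a) \<oplus>\<^bsub>W.UA\<^esub> ?B (M.T m a) t = \<zero>\<^bsub>W.UA\<^esub>"
      by (rule ext[OF _ _ t]) (use ma anti_pure in auto)
    then show "?B (M.T m a) t \<oplus>\<^bsub>W.UA\<^esub> ?B t (M.T m a) = \<zero>\<^bsub>W.UA\<^esub>"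
      using ma t by (simp add: WA.a_comm)
  qed
  have hom2: "(\<lambda>s. ?B s s) \<in> hom (add_monoid M.UA) (add_monoid W.UA)"
  proof -
    have "?B (s \<oplus>\<^bsub>M.UA\<^esub> t) (s \<oplus>\<^bsub>M.UA\<^esub> t) = ?B s s \<oplus>\<^bsub>W.UA\<^esub> ?B t t"
      if st: "s \<in> carrier M.UA" "t \<in> carrier M.UA" for s t
    proof -
      have "?B (s \<oplus>\<^bsub>M.UA\<^esub> t) (s \<oplus>\<^bsub>M.UA\<^esub> t)
          = (?B s s \<oplus>\<^bsub>W.UA\<^esub> ?B t t) \<oplus>\<^bsub>W.UA\<^esub> (?B s t \<oplus>\<^bsub>W.UA\<^esub> ?B t s)"
        using st by (simp add: WA.a_ac)
      also have "\<dots> = ?B s s \<oplus>\<^bsub>W.UA\<^esub> ?B t t" using st by (simp add: anti)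
      finally show ?thesis .
    qed
    then show ?thesis by (auto simp: hom_def)
  qed
  have "?B s s = \<zero>\<^bsub>W.UA\<^esub>" if "s \<in> carrier M.UA" for s
    by (rule M.UA_ext[OF WA.add.is_group hom2 hom0 _ that])
      (simp add: pure \<alpha>.alternating T0)
  with rep show ?thesis by (simp add: alternating_rep_def rep_mult_def)
qed

lemma double_rep_eq:
  assumes "module_rep R M V W \<theta>" "a \<in> carrier M" "x \<in> carrier V"
  shows "double_rep R M V W \<theta> a x = \<theta> a x \<oplus>\<^bsub>W\<^esub> \<theta> a x"
proof -
  interpret H: module R "hom_module R V W"
    using assms(1) by (intro module_hom_module) (auto simp: module_rep_def)
  have "\<theta> a \<in> carrier (hom_module R V W)"
    using assms mod_homD(1)[of \<theta> R M "hom_module R V W" a] by (simp add: module_rep_def)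
  then have "add_pow (hom_module R V W) (2::nat) (\<theta> a) = \<theta> a \<oplus>\<^bsub>hom_module R V W\<^esub> \<theta> a"
    by (simp add: numeral_2_eq_2 H.add.nat_pow_Suc del: hom_module_simps)
  then show ?thesis using assms by (simp add: double_rep_def)
qed

theorem lemma7p1:
  fixes R :: "('r, 'x) ring_scheme"
    and M :: "('r, 'm, 'y) module_scheme"
    and W :: "('r, 'w, 'z) module_scheme"
    and A :: "('r, 'a, 't) module_scheme"
    and \<alpha> :: "'m \<Rightarrow> 'm \<Rightarrow> 'w"
  assumes "cring R"
    and "alternating_rep R M W \<alpha>"
    and "algebra R A"
    and "finite (carrier (Baer_group R M W \<alpha> A))"
  shows "real (conj_class_number (Baer_group R M W \<alpha> A)) =
    real (card (carrier (base_change R A W))) *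
    ask (base_change R A M) (base_change R A M) (base_change R A W)
      (double_rep A (base_change R A M) (base_change R A M) (base_change R A W)
        (change_of_scalars R A M M W \<alpha>))"
proof -
  let ?M = "base_change R A M" and ?W = "base_change R A W"
  let ?\<theta> = "change_of_scalars R A M M W \<alpha>"
  have alt: "alternating_rep A ?M ?W ?\<theta>"
    by (rule change_of_scalars_alternating) fact+
  then have rep: "module_rep A ?M ?M ?W ?\<theta>" by (simp add: alternating_rep_def)
  interpret \<beta>: alternating_biadditive ?M ?W "rep_mult ?\<theta>"
    by (rule alternating_rep_biadditive[OF alt])
  have G: "Baer_group R M W \<alpha> A = \<beta>.extension"
    by (simp add: Baer_group_def \<beta>.extension_def Let_def)
  have "finite (carrier ?M \<times> carrier ?W)"
    using assms(4) by (simp add: G \<beta>.extension_def)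
  then have fin: "finite (carrier ?M)" "finite (carrier ?W)"
    using \<beta>.M.zero_closed \<beta>.W.zero_closed
    by (blast dest: finite_cartesian_productD1 finite_cartesian_productD2)+
  have ker: "a_kernel ?M ?W (double_rep A ?M ?M ?W ?\<theta> a) =
      {b \<in> carrier ?M. rep_mult ?\<theta> b a \<oplus>\<^bsub>?W\<^esub> rep_mult ?\<theta> b a = \<zero>\<^bsub>?W\<^esub>}" if "a \<in> carrier ?M" for a
    unfolding a_kernel_def' rep_mult_def
    by (intro Collect_cong conj_cong refl) (simp only: double_rep_eq[OF rep that])
  have "real (conj_class_number \<beta>.extension) * real (card (carrier ?M)) = real (card (carrier ?W)) *
      (\<Sum>a\<in>carrier ?M. real (card (a_kernel ?M ?W (double_rep A ?M ?M ?W ?\<theta> a))))"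
    using \<beta>.conj_class_number_extension[OF fin]
    by (simp add: ker flip: of_nat_mult of_nat_sum)
  moreover have "card (carrier ?M) > 0"
    using fin \<beta>.M.zero_closed by (auto simp: card_gt_0_iff)
  ultimately show ?thesis
    by (simp add: G ask_def field_simps)
qed

end
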